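(* Let $\mathbb{T}$ be a time scale with $\sup\mathbb{T}=\infty$, $t_0\in\mathbb{T}$, let $A:[t_0,\infty)_{\mathbb{T}}\to[0,\infty)$ and $\alpha:[t_0,\infty)_{\mathbb{T}}\to\mathbb{T}$ be rd-continuous with $\lim_{t\to\infty}\alpha(t)=\infty$, and consider the delay dynamic equation $$x^{\Delta}(t)+A(t)x(\alpha(t))=0,\qquad t\in[t_0,\infty)_{\mathbb{T}}. \quad (E)$$ Assume that $\alpha(\sigma(t))\le t$ for all $t\in[t_0,\infty)_{\mathbb{T}}$, that $$\sup_{s\in[t_0,\infty)_{\mathbb{T}}}\int_s^{\alpha_{-1}(s)}A(\eta)\,\Delta\eta<\infty ,$$ and that $$\int_{\alpha(t)}^{t}A(\eta)\,\Delta\eta\le1\quad\text{for all }t\in[t_0,\infty)_{\mathbb{T}} .$$ Then the trivial solution of (E) is uniformly stable.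
   Context: Time scales: a time scale $\mathbb{T}$ is a nonempty closed subset of $\mathbb{R}$; an interval with subscript $\mathbb{T}$ means its intersection with $\mathbb{T}$. $\sigma(t)=\inf(t,\infty)_{\mathbb{T}}$, $\mu(t)=\sigma(t)-t$; $t$ is right-dense if $\mu(t)=0$, right-scattered otherwise; left-dense and left-scattered points are defined similarly with $\rho(t)=\sup(-\infty,t)_{\mathbb{T}}$. $f^{\Delta}(t)$ is the $\Delta$-derivative: the number such that for every $\varepsilon>0$ there is a neighbourhood $U$ of $t$ in $\mathbb T$ with $|f(\sigma(t))-f(r)-f^{\Delta}(t)(\sigma(t)-r)|\le\varepsilon|\sigma(t)-r|$ for all $r\in U$. A function is rd-continuous if it is continuous at right-dense points and has finite limits at left-dense points. The $\Delta$-integral of an rd-continuous $f$ is $\int_s^t f(\eta)\Delta\eta=F(t)-F(s)$ with $F^{\Delta}=f$. Delay functions: $\alpha_*(t):=\inf\{\alpha(\eta):\eta\in[t,\infty)_{\mathbb{T}}\}$ and $\alpha_{-1}(t):=\sup\{\eta\in[t_0,\infty)_{\mathbb{T}}:\alpha_*(\eta)\le t\}$ for $t\in[t_0,\infty)_{\mathbb T}$. Initial value problem: for $s\in[t_0,\infty)_{\mathbb{T}}$, a solution of (E) with data $(s,x_0,\varphi)$ is a function $x:[\alpha_*(s),\infty)_{\mathbb{T}}\to\mathbb{R}$ that is rd-continuous on $[\alpha_*(s),s]_{\mathbb{T}}$, is $\Delta$-differentiable on $[s,\infty)_{\mathbb{T}}$ with an rd-continuous derivative, satisfies $x^{\Delta}(t)+A(t)x(\alpha(t))=0$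 identically on $[s,\infty)_{\mathbb{T}}$, and has $x(s)=x_0$ and $x(t)=\varphi(t)$ for $t\in[\alpha_*(s),s)_{\mathbb{T}}$. Uniform stability of the trivial solution: for every $\varepsilon>0$ there is $\delta>0$ such that for every $s\in[t_0,\infty)_{\mathbb{T}}$, every solution $x$ with data $(s,x_0,\varphi)$ satisfying $|x_0|+\sup_{\eta\in[\alpha_*(s),s)_{\mathbb{T}}}|\varphi(\eta)|<\delta$ satisfies $|x(t)|<\varepsilon$ for all $t\in[s,\infty)_{\mathbb{T}}$.
   Formalization: The formal theorem also assumes α(t) ≤ t for all t in [t_0,∞)_T (the meaning of "delay"); without it the claim fails, e.g. on T = Z with t_0 = 0 and α(0) = 4, where nonzero solutions with zero initial data exist. *)

theory Defs
  imports "HOL-Analysis.Analysis"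
begin

text \<open>
  Every notion takes the time scale as an argument. An interval such as \<open>[s,\<infinity>)\<close> of \<open>T\<close> is
  \<open>T \<inter> {s..}\<close>; being closed, it is a time scale itself, and a notion ``on the interval'' is
  the notion for that time scale. Functions are total on the reals, but only their values on the
  stated interval matter.
\<close>

definition time_scale :: "real set \<Rightarrow> bool" where
  "time_scale T \<longleftrightarrow> closed T \<and> T \<noteq> {}"

definition fwd_jump :: "real set \<Rightarrow> real \<Rightarrow> real" where
  "fwd_jump T t = Inf (T \<inter> {t<..})"

definition bwd_jump :: "real set \<Rightarrow> real \<Rightarrow> real" where
  "bwd_jump T t = Sup (T \<inter> {..<t})"

text \<open>
  A largest point is not right-dense and a least point is not left-dense. (The library's
  \<open>Inf {}\<close> and \<open>Sup {}\<close> on the reals carry no meaning.)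
\<close>

definition right_dense :: "real set \<Rightarrow> real \<Rightarrow> bool" where
  "right_dense T t \<longleftrightarrow> T \<inter> {t<..} \<noteq> {} \<and> fwd_jump T t = t"

definition left_dense :: "real set \<Rightarrow> real \<Rightarrow> bool" where
  "left_dense T t \<longleftrightarrow> T \<inter> {..<t} \<noteq> {} \<and> bwd_jump T t = t"

definition rd_continuous :: "real set \<Rightarrow> (real \<Rightarrow> real) \<Rightarrow> bool" where
  "rd_continuous T f \<longleftrightarrow>
     (\<forall>t\<in>T. (right_dense T t \<longrightarrow> continuous (at t within T) f) \<and>
            (left_dense T t \<longrightarrow> (\<exists>L. (f \<longlongrightarrow> L) (at t within (T \<inter> {..<t})))))"

definition has_delta_derivative :: "real set \<Rightarrow> (real \<Rightarrow> real) \<Rightarrow> real \<Rightarrow> real \<Rightarrow> bool" where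
  "has_delta_derivative T f D t \<longleftrightarrow>
     (\<forall>\<epsilon>>0. \<exists>d>0. \<forall>r\<in>T. \<bar>r - t\<bar> < d \<longrightarrow>
        \<bar>f (fwd_jump T t) - f r - D * (fwd_jump T t - r)\<bar> \<le> \<epsilon> * \<bar>fwd_jump T t - r\<bar>)"

definition delta_antiderivative :: "real set \<Rightarrow> (real \<Rightarrow> real) \<Rightarrow> (real \<Rightarrow> real) \<Rightarrow> bool" where
  "delta_antiderivative T f F \<longleftrightarrow> (\<forall>t\<in>T. has_delta_derivative T F (f t) t)"

text \<open>
  The integral of \<open>f\<close> from \<open>a\<close> to \<open>b\<close> (oriented), for \<open>a, b \<in> T\<close>, \<open>T\<close> unbounded above and
  \<open>f\<close> rd-continuous on \<open>T\<close>: an antiderivative then exists, and two of them differ by a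
  constant on \<open>T\<close>, so the value does not depend on the choice.
\<close>

definition delta_integral :: "real set \<Rightarrow> (real \<Rightarrow> real) \<Rightarrow> real \<Rightarrow> real \<Rightarrow> real" where
  "delta_integral T f a b = (let F = (SOME F. delta_antiderivative T f F) in F b - F a)"

definition alpha_star :: "real set \<Rightarrow> (real \<Rightarrow> real) \<Rightarrow> real \<Rightarrow> real" where
  "alpha_star T \<alpha> t = Inf (\<alpha> ` (T \<inter> {t..}))"

definition alpha_minus1 :: "real set \<Rightarrow> real \<Rightarrow> (real \<Rightarrow> real) \<Rightarrow> real \<Rightarrow> real" where
  "alpha_minus1 T t0 \<alpha> t = Sup {\<eta> \<in> T \<inter> {t0..}. alpha_star T \<alpha> \<eta> \<le> t}"

text \<open>
  At the initial point \<open>s\<close> the derivative is the one in the time scale \<open>[s,\<infinity>)\<close>, so the history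
  \<open>\<phi>\<close> may jump to the initial value \<open>x0\<close> at \<open>s\<close>.
\<close>

definition ivp_solution ::
  "real set \<Rightarrow> (real \<Rightarrow> real) \<Rightarrow> (real \<Rightarrow> real) \<Rightarrow> real \<Rightarrow> real \<Rightarrow> (real \<Rightarrow> real) \<Rightarrow>
     (real \<Rightarrow> real) \<Rightarrow> bool" where
  "ivp_solution T A \<alpha> s x0 \<phi> x \<longleftrightarrow>
     rd_continuous (T \<inter> {alpha_star T \<alpha> s..s}) x \<and>
     (\<exists>D. (\<forall>t \<in> T \<inter> {s..}. has_delta_derivative (T \<inter> {s..}) x (D t) t) \<and>
          rd_continuous (T \<inter> {s..}) D \<and>
          (\<forall>t \<in> T \<inter> {s..}. D t + A t * x (\<alpha> t) = 0)) \<and>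
     x s = x0 \<and>
     (\<forall>t \<in> T \<inter> {alpha_star T \<alpha> s..<s}. x t = \<phi> t)"

text \<open>
  The supremum is taken in \<open>[0,\<infinity>]\<close>, so that it is \<open>0\<close> when the history interval is empty.
\<close>

definition uniformly_stable ::
  "real set \<Rightarrow> real \<Rightarrow> (real \<Rightarrow> real) \<Rightarrow> (real \<Rightarrow> real) \<Rightarrow> bool" where
  "uniformly_stable T t0 A \<alpha> \<longleftrightarrow>
     (\<forall>\<epsilon>>0. \<exists>\<delta>>0. \<forall>s \<in> T \<inter> {t0..}. \<forall>x0 \<phi> x.
        ivp_solution T A \<alpha> s x0 \<phi> x \<and>
        ennreal \<bar>x0\<bar> + (SUP \<eta> \<in> T \<inter> {alpha_star T \<alpha> s..<s}. ennreal \<bar>\<phi> \<eta>\<bar>) < ennreal \<delta>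
        \<longrightarrow> (\<forall>t \<in> T \<inter> {s..}. \<bar>x t\<bar> < \<epsilon>))"

end

theory Submission
  imports Defs
begin

text \<open>
  Let \<open>F\<close> be an antiderivative of \<open>A\<close> and \<open>a = \<alpha>\<^sub>-\<^sub>1(s)\<close>. On \<open>[s,a]\<close> a Gronwall argument bounds \<open>\<bar>x\<bar>\<close> by
  \<open>\<delta> exp (F(a) - F(s))\<close>, which the first integral condition controls uniformly in \<open>s\<close>. Beyond \<open>a\<close>
  the delayed argument stays in \<open>[s,\<infinity>)\<close>, so if \<open>\<bar>x\<bar> \<le> K\<close> up to \<open>t\<close>, the second condition gives
  \<open>\<bar>x(t) - x(\<alpha>(t))\<bar> \<le> K\<close>. Hence \<open>x(t) - h x(\<alpha>(t)) = (1 - h) x(t) + h (x(t) - x(\<alpha>(t)))\<close> is again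
  at most \<open>K\<close> in modulus for \<open>0 \<le> h \<le> 1\<close>. A step of the equation has this form:
  \<open>h = A(t) \<mu>(t) \<le> 1\<close> at a right-scattered \<open>t\<close>, because \<open>\<alpha>(\<sigma>(t)) \<le> t\<close> puts \<open>[t,\<sigma>(t))\<close> inside a
  window of integral at most \<open>1\<close>, and \<open>h = A(t) (r - t)\<close> up to \<open>o(r - t)\<close> at a right-dense \<open>t\<close>.
  Only the step out of \<open>a\<close> itself, whose delayed argument may lie before \<open>s\<close>, can double the bound.
\<close>

section \<open>Regulated functions\<close>

text \<open>One-sided limits make \<open>f\<close> uniformly close to step functions: around each
  \<open>u\<close> there is a ball on which \<open>f\<close> stays within \<open>e\<close> of one
  constant left of \<open>u\<close> and of another right of it. A tagged division fine for these
  balls glues the pieces, and uniform limits of integrable functions are integrable.\<close>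

lemma regulated_integrable:
  fixes f :: "real \<Rightarrow> real"
  assumes left: "\<And>u. \<exists>l. (f \<longlongrightarrow> l) (at_left u)"
    and right: "\<And>u. \<exists>l. (f \<longlongrightarrow> l) (at_right u)"
  shows "f integrable_on {a..b}"
proof -
  have "f integrable_on cbox a b"
  proof (rule integrable_uniform_limit)
    fix e :: real
    assume e: "e > 0"
    have "\<exists>L R d. d > 0 \<and> (\<forall>v. u - d < v \<longrightarrow> v < u \<longrightarrow> \<bar>f v - L\<bar> < e) \<and>
        (\<forall>v. u < v \<longrightarrow> v < u + d \<longrightarrow> \<bar>f v - R\<bar> < e)" for u
    proof -
      obtain L R where "(f \<longlongrightarrow> L) (at_left u)" "(f \<longlongrightarrow> R) (at_right u)"
        using left right by blast
      then have "\<forall>\<^sub>F v in at_left u. dist (f v) L < e" "\<forall>\<^sub>F v in at_right u. dist (f v) R < e"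
        using e tendstoD by blast+
      then obtain p q where "p < u" "\<And>v. p < v \<Longrightarrow> v < u \<Longrightarrow> dist (f v) L < e"
        "u < q" "\<And>v. u < v \<Longrightarrow> v < q \<Longrightarrow> dist (f v) R < e"
        unfolding eventually_at_left_field eventually_at_right_field by blast
      then show ?thesis
        by (intro exI[of _ L] exI[of _ R] exI[of _ "min (u - p) (q - u)"]) (auto simp: dist_real_def)
    qed
    then obtain L R d where d: "\<And>u. d u > 0"
      and L: "\<And>u v. u - d u < v \<Longrightarrow> v < u \<Longrightarrow> \<bar>f v - L u\<bar> < e"
      and R: "\<And>u v. u < v \<Longrightarrow> v < u + d u \<Longrightarrow> \<bar>f v - R u\<bar> < e"
      by metis
    have "gauge (\<lambda>u. ball u (d u))"
      using d by (simp add: gauge_def)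
    then obtain p where ptag: "p tagged_division_of cbox a b" and fine: "(\<lambda>u. ball u (d u)) fine p"
      using fine_division_exists by blast
    have *: "\<forall>i\<in>snd ` p. \<exists>g. (\<forall>y\<in>i. norm (f y - g y) \<le> e) \<and> g integrable_on i"
    proof clarsimp
      fix u l
      assume ul: "(u, l) \<in> p"
      obtain c c' where l: "l = cbox c c'"
        using ul ptag by blast
      then have u: "c \<le> u" "u \<le> c'"
        using ul ptag by (auto dest: tagged_division_ofD(2))
      \<comment> \<open>The limits say nothing about the value at the tag \<open>u\<close>, so
        \<open>g\<close> copies \<open>f u\<close> there; one point does not affect
        integrability.\<close>
      define g where "g = (\<lambda>y. if y < u then L u else if y = u then f u else R u)"
      have "g integrable_on {c..u}"
        by (rule integrable_spike_finite[of "{u}" _ _ "\<lambda>_. L u"]) (auto simp: g_def)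
      moreover have "g integrable_on {u..c'}"
        by (rule integrable_spike_finite[of "{u}" _ _ "\<lambda>_. R u"]) (auto simp: g_def)
      ultimately have "g integrable_on l"
        unfolding l using Henstock_Kurzweil_Integration.integrable_combine[OF u] by simp
      moreover have "\<bar>f y - g y\<bar> \<le> e" if "y \<in> l" for y
      proof -
        have "y \<in> ball u (d u)"
          using ul fine that by fastforce
        then show ?thesis
          using L[of u y] R[of u y] e by (auto simp: g_def dist_real_def)
      qed
      ultimately show "\<exists>g. (\<forall>y\<in>l. \<bar>f y - g y\<bar> \<le> e) \<and> g integrable_on l"
        by blast
    qed
    show "\<exists>g. (\<forall>y\<in>cbox a b. norm (f y - g y) \<le> e) \<and> g integrable_on cbox a b"
      using approximable_on_division[OF less_imp_le[OF e] division_of_tagged_division[OF ptag] *]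
      by blast
  qed
  then show ?thesis
    by simp
qed

text \<open>The two one-sided limits and the value at a point give a bound near it. Finitely many
  such neighbourhoods cover the compact interval, and the sum of their bounds is a common
  one.\<close>

lemma regulated_bounded:
  fixes f :: "real \<Rightarrow> real"
  assumes left: "\<And>u. \<exists>l. (f \<longlongrightarrow> l) (at_left u)"
    and right: "\<And>u. \<exists>l. (f \<longlongrightarrow> l) (at_right u)"
  shows "\<exists>K. \<forall>v\<in>{a..b}. \<bar>f v\<bar> \<le> K"
proof -
  have "\<exists>d K. d > 0 \<and> (\<forall>v\<in>ball u d. \<bar>f v\<bar> \<le> K)" for u
  proof -
    obtain L R where "(f \<longlongrightarrow> L) (at_left u)" "(f \<longlongrightarrow> R) (at_right u)"
      using left right by blast
    then have "\<forall>\<^sub>F v in at_left u. dist (f v) L < 1" "\<forall>\<^sub>F v in at_right u. dist (f v) R < 1"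
      using tendstoD zero_less_one by blast+
    then obtain p q where pq: "p < u" "\<And>v. p < v \<Longrightarrow> v < u \<Longrightarrow> dist (f v) L < 1"
      "u < q" "\<And>v. u < v \<Longrightarrow> v < q \<Longrightarrow> dist (f v) R < 1"
      unfolding eventually_at_left_field eventually_at_right_field by blast
    have "\<bar>f v\<bar> \<le> \<bar>L\<bar> + \<bar>R\<bar> + \<bar>f u\<bar> + 1" if "v \<in> ball u (min (u - p) (q - u))" for v
      using pq(2,4)[of v] that by (cases v u rule: linorder_cases) (auto simp: dist_real_def)
    then show ?thesis
      using pq(1,3) by (intro exI[of _ "min (u - p) (q - u)"] exI[of _ "\<bar>L\<bar> + \<bar>R\<bar> + \<bar>f u\<bar> + 1"]) simp
  qed
  then obtain d K where d: "\<And>u. d u > 0" and K: "\<And>u v. v \<in> ball u (d u) \<Longrightarrow> \<bar>f v\<bar> \<le> K u"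
    by metis
  have "compact {a..b}" "{a..b} \<subseteq> (\<Union>u\<in>{a..b}. ball u (d u))"
    using d by auto
  then obtain C where C: "C \<subseteq> {a..b}" "finite C" "{a..b} \<subseteq> (\<Union>u\<in>C. ball u (d u))"
    using compactE_image[of "{a..b}" "{a..b}" "\<lambda>u. ball u (d u)"] by auto
  have "\<bar>f v\<bar> \<le> (\<Sum>u\<in>C. \<bar>K u\<bar>)" if v: "v \<in> {a..b}" for v
  proof -
    obtain u where u: "u \<in> C" "v \<in> ball u (d u)"
      using C(3) v by blast
    then have "\<bar>f v\<bar> \<le> \<bar>K u\<bar>"
      using K by fastforce
    also have "\<dots> \<le> (\<Sum>u\<in>C. \<bar>K u\<bar>)"
      using u C by (intro member_le_sum) auto
    finally show ?thesis .
  qed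
  then show ?thesis
    by blast
qed

section \<open>Calculus on time scales\<close>

text \<open>Composing with it extends a function on \<open>S\<close> to the real line, constant on
  the gaps of \<open>S\<close>. This turns rd-continuity into the existence of one-sided limits and
  the delta integral into an ordinary one.\<close>

definition last_point :: "real set \<Rightarrow> real \<Rightarrow> real" where
  "last_point S u = Sup (S \<inter> {..u})"

lemma last_point_eq: "u \<in> S \<Longrightarrow> last_point S u = u"
  unfolding last_point_def by (rule cSup_eq_maximum) auto

lemma last_point_ge: "r \<in> S \<Longrightarrow> r \<le> u \<Longrightarrow> r \<le> last_point S u"
  unfolding last_point_def by (rule cSup_upper) auto

lemma last_point_in:
  assumes "closed S" "r \<in> S" "r \<le> u"
  shows "last_point S u \<in> S" "last_point S u \<le> u"
proof -
  have "last_point S u \<in> S \<inter> {..u}"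
    unfolding last_point_def using assms by (intro closed_contains_Sup) auto
  then show "last_point S u \<in> S" "last_point S u \<le> u"
    by auto
qed

lemma left_denseI:
  assumes "closed S" "\<And>e. e > 0 \<Longrightarrow> S \<inter> {u - e<..<u} \<noteq> {}"
  shows "u \<in> S" "left_dense S u"
proof -
  have "\<exists>r\<in>S. dist r u < e" if "e > 0" for e
    using assms(2)[OF that] by (force simp: dist_real_def)
  then show "u \<in> S"
    using \<open>closed S\<close> closed_approachable by blast
  have ne: "S \<inter> {..<u} \<noteq> {}"
    using assms(2)[of 1] by auto
  have "Sup (S \<inter> {..<u}) = u"
  proof (rule cSup_eq_non_empty[OF ne])
    fix y
    assume y: "\<And>x. x \<in> S \<inter> {..<u} \<Longrightarrow> x \<le> y"
    show "u \<le> y"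
    proof (rule ccontr)
      assume "\<not> u \<le> y"
      then obtain r where "r \<in> S" "y < r" "r < u"
        using assms(2)[of "u - y"] by auto
      then show False
        using y[of r] by auto
    qed
  qed auto
  then show "left_dense S u"
    using ne by (simp add: left_dense_def bwd_jump_def)
qed

lemma right_denseI:
  assumes "closed S" "\<And>e. e > 0 \<Longrightarrow> S \<inter> {u<..<u + e} \<noteq> {}"
  shows "u \<in> S" "right_dense S u"
proof -
  have "\<exists>r\<in>S. dist r u < e" if "e > 0" for e
    using assms(2)[OF that] by (force simp: dist_real_def)
  then show "u \<in> S"
    using \<open>closed S\<close> closed_approachable by blast
  have ne: "S \<inter> {u<..} \<noteq> {}"
    using assms(2)[of 1] by auto
  have "Inf (S \<inter> {u<..}) = u"
  proof (rule cInf_eq_non_empty[OF ne])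
    fix y
    assume y: "\<And>x. x \<in> S \<inter> {u<..} \<Longrightarrow> y \<le> x"
    show "y \<le> u"
    proof (rule ccontr)
      assume "\<not> y \<le> u"
      then obtain r where "r \<in> S" "u < r" "r < y"
        using assms(2)[of "y - u"] by auto
      then show False
        using y[of r] by auto
    qed
  qed auto
  then show "right_dense S u"
    using ne by (simp add: right_dense_def fwd_jump_def)
qed

text \<open>Either \<open>S\<close> accumulates at \<open>u\<close> from the left, so that
  \<open>u\<close> is a left-dense point of \<open>S\<close> and the limit of \<open>f\<close> there
  is the one sought, or \<open>S\<close> has no points just left of \<open>u\<close> and the
  extension is constant there.\<close>

lemma rd_continuous_left_limit:
  assumes "closed S" "rd_continuous S f"
  shows "\<exists>l. ((\<lambda>v. f (last_point S v)) \<longlongrightarrow> l) (at_left u)"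
proof (cases "\<forall>e>0. S \<inter> {u - e<..<u} \<noteq> {}")
  case True
  then have "u \<in> S" "left_dense S u"
    using left_denseI[OF \<open>closed S\<close>] by blast+
  then obtain L where L: "(f \<longlongrightarrow> L) (at u within (S \<inter> {..<u}))"
    using assms(2) unfolding rd_continuous_def by blast
  have "((\<lambda>v. f (last_point S v)) \<longlongrightarrow> L) (at_left u)"
  proof (rule tendstoI)
    fix e :: real
    assume "e > 0"
    then obtain d where d: "d > 0" "\<And>r. r \<in> S \<Longrightarrow> r < u \<Longrightarrow> u - r < d \<Longrightarrow> dist (f r) L < e"
      using tendstoD[OF L] unfolding eventually_at by (force simp: dist_real_def)
    \<comment> \<open>For \<open>v\<close> between \<open>p\<close> and \<open>u\<close>,
      \<open>last_point S v\<close> lies between \<open>p\<close> and \<open>v\<close>, hence within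
      \<open>d\<close> of \<open>u\<close>.\<close>
    obtain p where p: "p \<in> S" "u - d < p" "p < u"
      using True d(1) by fastforce
    have "dist (f (last_point S v)) L < e" if "p < v" "v < u" for v
      using d(2)[of "last_point S v"] last_point_in[OF \<open>closed S\<close> p(1), of v]
        last_point_ge[OF p(1), of v] p that by simp
    then show "\<forall>\<^sub>F v in at_left u. dist (f (last_point S v)) L < e"
      unfolding eventually_at_left_field using p by blast
  qed
  then show ?thesis ..
next
  case False
  then obtain e where e: "e > 0" "S \<inter> {u - e<..<u} = {}"
    by blast
  have "last_point S v = last_point S (u - e)" if "u - e < v" "v < u" for v
  proof -
    \<comment> \<open>Comparing the sets whose suprema are taken also covers the case that
      \<open>S\<close> has no point up to \<open>v\<close>.\<close>
    have "x \<le> v \<longleftrightarrow> x \<le> u - e" if "x \<in> S" for x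
    proof -
      have "x \<notin> {u - e<..<u}"
        using e that by blast
      then show ?thesis
        using \<open>u - e < v\<close> \<open>v < u\<close> by auto
    qed
    then have "S \<inter> {..v} = S \<inter> {..u - e}"
      by blast
    then show ?thesis
      by (simp add: last_point_def)
  qed
  then have "\<forall>\<^sub>F v in at_left u. f (last_point S v) = f (last_point S (u - e))"
    unfolding eventually_at_left_field using e by (intro exI[of _ "u - e"]) auto
  then show ?thesis
    by (intro exI) (rule tendsto_eventually)
qed

text \<open>The same dichotomy on the other side. At a right-dense point the limit is
  \<open>f u\<close>, by continuity there.\<close>

lemma rd_continuous_right_limit:
  assumes "closed S" "rd_continuous S f"
  shows "\<exists>l. ((\<lambda>v. f (last_point S v)) \<longlongrightarrow> l) (at_right u)"
proof (cases "\<forall>e>0. S \<inter> {u<..<u + e} \<noteq> {}")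
  case True
  then have u: "u \<in> S" "right_dense S u"
    using right_denseI[OF \<open>closed S\<close>] by blast+
  then have L: "(f \<longlongrightarrow> f u) (at u within S)"
    using assms(2) unfolding rd_continuous_def continuous_within by blast
  have "((\<lambda>v. f (last_point S v)) \<longlongrightarrow> f u) (at_right u)"
  proof (rule tendstoI)
    fix e :: real
    assume "e > 0"
    then obtain d where d: "d > 0" "\<And>r. r \<in> S \<Longrightarrow> u < r \<Longrightarrow> r - u < d \<Longrightarrow> dist (f r) (f u) < e"
      using tendstoD[OF L] unfolding eventually_at by (force simp: dist_real_def)
    have "dist (f (last_point S v)) (f u) < e" if "u < v" "v < u + d" for v
      using d(2)[of "last_point S v"] last_point_in[OF \<open>closed S\<close> u(1), of v]
        last_point_ge[OF u(1), of v] that \<open>e > 0\<close> by (cases "last_point S v = u") auto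
    then show "\<forall>\<^sub>F v in at_right u. dist (f (last_point S v)) (f u) < e"
      unfolding eventually_at_right_field using d by (intro exI[of _ "u + d"]) auto
  qed
  then show ?thesis ..
next
  case False
  then obtain e where e: "e > 0" "S \<inter> {u<..<u + e} = {}"
    by blast
  have "last_point S v = last_point S u" if "u < v" "v < u + e" for v
  proof -
    have "x \<le> v \<longleftrightarrow> x \<le> u" if "x \<in> S" for x
    proof -
      have "x \<notin> {u<..<u + e}"
        using e that by blast
      then show ?thesis
        using \<open>u < v\<close> \<open>v < u + e\<close> by auto
    qed
    then have "S \<inter> {..v} = S \<inter> {..u}"
      by blast
    then show ?thesis
      by (simp add: last_point_def)
  qed
  then have "\<forall>\<^sub>F v in at_right u. f (last_point S v) = f (last_point S u)"
    unfolding eventually_at_right_field using e by (intro exI[of _ "u + e"]) auto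
  then show ?thesis
    by (intro exI) (rule tendsto_eventually)
qed

lemma rd_continuous_bounded:
  assumes "closed S" "rd_continuous S f"
  shows "\<exists>K. \<forall>t \<in> S \<inter> {a..b}. \<bar>f t\<bar> \<le> K"
proof -
  obtain K where K: "\<And>v. v \<in> {a..b} \<Longrightarrow> \<bar>f (last_point S v)\<bar> \<le> K"
    using regulated_bounded[of "\<lambda>v. f (last_point S v)"] rd_continuous_left_limit[OF assms]
      rd_continuous_right_limit[OF assms] by blast
  show ?thesis
    using K last_point_eq by (metis IntD1 IntD2)
qed

section \<open>Forward jumps and existence of antiderivatives\<close>

lemma fwd_jump_in:
  assumes "closed S" "\<not> bdd_above S"
  shows "fwd_jump S t \<in> S" "t \<le> fwd_jump S t"
proof -
  have ne: "S \<inter> {t<..} \<noteq> {}"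
    using assms(2) unfolding bdd_above_def by (metis disjoint_iff greaterThan_iff not_le)
  have bd: "bdd_below (S \<inter> {t<..})"
    by (intro bdd_belowI[of _ t]) auto
  have "fwd_jump S t \<in> closure (S \<inter> {t<..})"
    unfolding fwd_jump_def by (rule closure_contains_Inf[OF ne bd])
  also have "\<dots> \<subseteq> S"
    using assms(1) by (intro closure_minimal) auto
  finally show "fwd_jump S t \<in> S" .
  show "t \<le> fwd_jump S t"
    unfolding fwd_jump_def by (rule cInf_greatest[OF ne]) auto
qed

lemma fwd_jump_le: "r \<in> S \<Longrightarrow> t < r \<Longrightarrow> fwd_jump S t \<le> r"
  unfolding fwd_jump_def by (rule cInf_lower) (auto intro: bdd_belowI[of _ t])

lemma right_dense_iff:
  assumes "\<not> bdd_above S"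
  shows "right_dense S t \<longleftrightarrow> fwd_jump S t = t"
  using assms unfolding right_dense_def bdd_above_def by (metis disjoint_iff greaterThan_iff not_le)

text \<open>
  The antiderivative is the indefinite integral of the step-like extension that is constant on
  the gaps of the time scale.
\<close>

lemma delta_antiderivative_exists:
  assumes S: "closed S" "\<not> bdd_above S" "t0 \<in> S" "\<And>t. t \<in> S \<Longrightarrow> t0 \<le> t"
    and f: "rd_continuous S f"
  shows "\<exists>F. delta_antiderivative S f F"
proof -
  define g where "g = (\<lambda>v. f (last_point S v))"
  have int: "g integrable_on {a..b}" for a b
    unfolding g_def
    using rd_continuous_left_limit[OF S(1) f] rd_continuous_right_limit[OF S(1) f]
    by (rule regulated_integrable)
  define F where "F = (\<lambda>t. integral {t0..t} g)"
  have F_diff: "F r - F t = integral {t..r} g" if "t0 \<le> t" "t \<le> r" for t r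
    unfolding F_def using Henstock_Kurzweil_Integration.integral_combine[OF that int] by simp
  have F_cont: "continuous_on {t0..b} F" for b
    unfolding F_def by (rule indefinite_integral_continuous_1[OF int])
  \<comment> \<open>The bound on \<open>g\<close> is asked for on [t,r) only, the endpoint being
    negligible: at a right-scattered \<open>t\<close> the extension equals \<open>f t\<close> up to,
    but perhaps not at, the jump.\<close>
  have est: "\<bar>F r - F t - c * (r - t)\<bar> \<le> e * (r - t)"
    if "t0 \<le> t" "t \<le> r" "\<And>v. t \<le> v \<Longrightarrow> v < r \<Longrightarrow> \<bar>g v - c\<bar> \<le> e" "e \<ge> 0" for t r c e
  proof -
    have "((\<lambda>v. g v - c) has_integral (F r - F t - c * (r - t))) (cbox t r)"
      using has_integral_diff[OF integrable_integral[OF int[of t r]] has_integral_const_real[of c t r]]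
        that by (simp add: F_diff mult.commute)
    then show ?thesis
      using has_integral_bound_spike_finite[of e "{r}" "\<lambda>v. g v - c" _ t r] that by auto
  qed
  have "has_delta_derivative S F (f t) t" if t: "t \<in> S" for t
    unfolding has_delta_derivative_def
  proof (intro allI impI)
    fix e :: real
    assume e: "e > 0"
    show "\<exists>d>0. \<forall>r\<in>S. \<bar>r - t\<bar> < d \<longrightarrow> \<bar>F (fwd_jump S t) - F r - f t * (fwd_jump S t - r)\<bar>
        \<le> e * \<bar>fwd_jump S t - r\<bar>"
    proof (cases "fwd_jump S t = t")
      case True
      then have "continuous (at t within S) f"
        using f t right_dense_iff[OF S(2)] unfolding rd_continuous_def by blast
      then obtain d where d: "d > 0" "\<And>r. r \<in> S \<Longrightarrow> \<bar>r - t\<bar> < d \<Longrightarrow> \<bar>f r - f t\<bar> < e"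
        using e unfolding continuous_within_eps_delta by (metis dist_real_def)
      have near: "\<bar>g v - f t\<bar> \<le> e" if "p \<in> S" "p \<le> v" "v \<le> q" "\<bar>p - t\<bar> < d" "\<bar>q - t\<bar> < d" for v p q
      proof -
        have "p \<le> last_point S v" "last_point S v \<le> v" "last_point S v \<in> S"
          using last_point_in[OF S(1) that(1,2)] last_point_ge[OF that(1,2)] by auto
        moreover from this have "\<bar>last_point S v - t\<bar> < d"
          using that by linarith
        ultimately show ?thesis
          using d(2) by (force simp: g_def)
      qed
      have "\<bar>F t - F r - f t * (t - r)\<bar> \<le> e * \<bar>t - r\<bar>" if r: "r \<in> S" "\<bar>r - t\<bar> < d" for r
      proof (cases "r \<le> t")
        case True
        have "\<bar>F t - F r - f t * (t - r)\<bar> \<le> e * (t - r)"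
          using True S r d e by (intro est near[of r _ t]) auto
        then show ?thesis
          using True by simp
      next
        case False
        have "\<bar>F r - F t - f t * (r - t)\<bar> \<le> e * (r - t)"
          using False S r t d e by (intro est near[of t _ r]) auto
        then show ?thesis
          using False by (simp add: algebra_simps abs_minus_commute)
      qed
      then show ?thesis
        using d(1) True by auto
    next
      case False
      define \<sigma> where "\<sigma> = fwd_jump S t"
      have \<sigma>: "t < \<sigma>"
        using False fwd_jump_in[OF S(1,2), of t] by (simp add: \<sigma>_def)
      have "last_point S v = t" if "t \<le> v" "v < \<sigma>" for v
        using last_point_in[OF S(1) t that(1)] last_point_ge[OF t that(1)]
          fwd_jump_le[of "last_point S v" S t] that by (force simp: \<sigma>_def)
      \<comment> \<open>Tolerance 0 in \<open>est\<close> yields an exact identity.\<close>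
      then have "\<bar>F \<sigma> - F t - f t * (\<sigma> - t)\<bar> \<le> 0 * (\<sigma> - t)"
        using S t \<sigma> by (intro est) (auto simp: g_def)
      then have jump: "F \<sigma> = F t + f t * (\<sigma> - t)"
        by simp
      \<comment> \<open>Points of \<open>S\<close> closer to \<open>t\<close> than
        \<open>\<sigma> - t\<close> lie at or left of \<open>t\<close>. For such \<open>r\<close>
        the identity \<open>jump\<close> makes the error an increment of
        \<open>F r - f t * r\<close>, so continuity suffices; the tolerance
        \<open>e * (\<sigma> - t)\<close> is at most \<open>e * (\<sigma> - r)\<close>.\<close>
      have "continuous_on {t0..\<sigma>} (\<lambda>r. F r - f t * r)"
        by (intro continuous_intros F_cont)
      then have "\<exists>d>0. \<forall>r\<in>{t0..\<sigma>}. dist r t < d \<longrightarrow> dist (F r - f t * r) (F t - f t * t) < e * (\<sigma> - t)"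
        using S(4)[OF t] \<sigma> e unfolding continuous_on_iff by auto
      then obtain d where d: "d > 0"
        "\<And>r. t0 \<le> r \<Longrightarrow> r \<le> \<sigma> \<Longrightarrow> \<bar>r - t\<bar> < d \<Longrightarrow> \<bar>(F r - f t * r) - (F t - f t * t)\<bar> < e * (\<sigma> - t)"
        by (auto simp: dist_real_def)
      have "\<bar>F \<sigma> - F r - f t * (\<sigma> - r)\<bar> \<le> e * \<bar>\<sigma> - r\<bar>"
        if r: "r \<in> S" "\<bar>r - t\<bar> < min d (\<sigma> - t)" for r
      proof -
        have "r \<le> t"
          using fwd_jump_le[OF r(1), of t] r by (force simp: \<sigma>_def)
        have "\<bar>F \<sigma> - F r - f t * (\<sigma> - r)\<bar> = \<bar>(F r - f t * r) - (F t - f t * t)\<bar>"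
          by (simp add: jump algebra_simps abs_minus_commute)
        also have "\<dots> \<le> e * (\<sigma> - t)"
          using d(2)[of r] S(4)[OF r(1)] r \<open>r \<le> t\<close> \<sigma> by auto
        also have "\<dots> \<le> e * \<bar>\<sigma> - r\<bar>"
          using \<open>r \<le> t\<close> \<sigma> e by simp
        finally show ?thesis .
      qed
      then show ?thesis
        using d(1) \<sigma> by (intro exI[of _ "min d (\<sigma> - t)"]) (auto simp: \<sigma>_def)
    qed
  qed
  then show ?thesis
    unfolding delta_antiderivative_def by blast
qed

section \<open>Elementary properties of the delta derivative\<close>

lemma delta_derivative_jump:
  assumes "has_delta_derivative S f D t" "t \<in> S"
  shows "f (fwd_jump S t) = f t + D * (fwd_jump S t - t)"
proof -
  define \<sigma> where "\<sigma> = fwd_jump S t"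
  \<comment> \<open>The point \<open>r = t\<close> lies in every neighbourhood of \<open>t\<close>,
    so the defining estimate may be read there.\<close>
  have le: "\<bar>f \<sigma> - f t - D * (\<sigma> - t)\<bar> \<le> e * \<bar>\<sigma> - t\<bar>" if "e > 0" for e
    using assms that unfolding has_delta_derivative_def \<sigma>_def by (metis abs_zero diff_self)
  have "\<bar>f \<sigma> - f t - D * (\<sigma> - t)\<bar> \<le> 0 + e" if "e > 0" for e
  proof -
    \<comment> \<open>The added 1 keeps the tolerance positive when
      \<open>\<sigma> = t\<close>.\<close>
    have "\<bar>f \<sigma> - f t - D * (\<sigma> - t)\<bar> \<le> e / (\<bar>\<sigma> - t\<bar> + 1) * \<bar>\<sigma> - t\<bar>"
      using that by (intro le) (simp add: add_nonneg_pos)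
    also have "\<dots> \<le> e"
      using that by (simp add: field_simps)
    finally show ?thesis
      by simp
  qed
  then have "\<bar>f \<sigma> - f t - D * (\<sigma> - t)\<bar> \<le> 0"
    by (rule field_le_epsilon)
  then show ?thesis
    by (simp add: \<sigma>_def)
qed

lemma delta_derivative_right_dense:
  assumes "has_delta_derivative S f D t" "fwd_jump S t = t" "e > 0"
  obtains d where "d > 0"
    "\<And>r. r \<in> S \<Longrightarrow> t < r \<Longrightarrow> r < t + d \<Longrightarrow> \<bar>f r - f t - D * (r - t)\<bar> \<le> e * (r - t)"
proof -
  obtain d where d: "d > 0"
    "\<And>r. r \<in> S \<Longrightarrow> \<bar>r - t\<bar> < d \<Longrightarrow> \<bar>f t - f r - D * (t - r)\<bar> \<le> e * \<bar>t - r\<bar>"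
    using assms unfolding has_delta_derivative_def by metis
  show thesis
  proof (rule that[OF d(1)])
    fix r
    assume r: "r \<in> S" "t < r" "r < t + d"
    have "f r - f t - D * (r - t) = - (f t - f r - D * (t - r))"
      by (simp add: algebra_simps)
    then show "\<bar>f r - f t - D * (r - t)\<bar> \<le> e * (r - t)"
      using d(2)[OF r(1)] r by simp
  qed
qed

text \<open>The jump formula eliminates \<open>f \<sigma>\<close> from the defining estimate, which
  then bounds \<open>f t - f r + D * (r - t)\<close>. The constants \<open>e'\<close> and
  \<open>d'\<close> allot \<open>e / 2\<close> to this bound and \<open>e / 2\<close> to the linear
  term.\<close>

lemma delta_derivative_continuous:
  assumes "has_delta_derivative S f D t" "t \<in> S"
  shows "continuous (at t within S) f"
  unfolding continuous_within_eps_delta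
proof (intro allI impI)
  fix e :: real
  assume e: "e > 0"
  define \<sigma> where "\<sigma> = fwd_jump S t"
  define e' where "e' = e / (2 * (\<bar>\<sigma> - t\<bar> + 1))"
  have e': "e' > 0"
    using e by (simp add: e'_def add_nonneg_pos)
  obtain d where d: "d > 0"
    "\<And>r. r \<in> S \<Longrightarrow> \<bar>r - t\<bar> < d \<Longrightarrow> \<bar>f \<sigma> - f r - D * (\<sigma> - r)\<bar> \<le> e' * \<bar>\<sigma> - r\<bar>"
    using assms e' unfolding has_delta_derivative_def \<sigma>_def by metis
  define d' where "d' = min d (min 1 (e / (2 * (\<bar>D\<bar> + 1))))"
  have "d' > 0"
    using d e by (simp add: d'_def add_nonneg_pos)
  moreover have "dist (f r) (f t) < e" if r: "r \<in> S" "dist r t < d'" for r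
  proof -
    have r': "\<bar>r - t\<bar> < d" "\<bar>r - t\<bar> < 1" "\<bar>r - t\<bar> < e / (2 * (\<bar>D\<bar> + 1))"
      using r by (auto simp: d'_def dist_real_def)
    have "e' * \<bar>\<sigma> - r\<bar> \<le> e' * (\<bar>\<sigma> - t\<bar> + 1)"
      using r' e' by (intro mult_left_mono) auto
    also have "\<dots> = e / 2"
      by (simp add: e'_def field_simps add_nonneg_eq_0_iff)
    finally have 1: "e' * \<bar>\<sigma> - r\<bar> \<le> e / 2" .
    have "\<bar>D * (r - t)\<bar> \<le> (\<bar>D\<bar> + 1) * \<bar>r - t\<bar>"
      by (simp add: abs_mult distrib_right)
    also have "\<dots> < e / 2"
      using r'(3) by (simp add: field_simps add_nonneg_pos)
    finally have 2: "\<bar>D * (r - t)\<bar> < e / 2" .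
    have "f \<sigma> - f r - D * (\<sigma> - r) = f t - f r + D * (r - t)"
      using delta_derivative_jump[OF assms] by (simp add: \<sigma>_def algebra_simps)
    then have "\<bar>f t - f r + D * (r - t)\<bar> \<le> e' * \<bar>\<sigma> - r\<bar>"
      using d(2)[OF r(1) r'(1)] by simp
    then show ?thesis
      using 1 2 by (simp add: dist_real_def)
  qed
  ultimately show "\<exists>d>0. \<forall>r\<in>S. dist r t < d \<longrightarrow> dist (f r) (f t) < e"
    by blast
qed

lemma has_delta_derivative_add:
  assumes "has_delta_derivative S f D t" "has_delta_derivative S g E t"
  shows "has_delta_derivative S (\<lambda>r. f r + g r) (D + E) t"
  unfolding has_delta_derivative_def
proof (intro allI impI)
  fix e :: real
  assume "e > 0"
  then have e: "e / 2 > 0"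
    by simp
  obtain d1 where d1: "d1 > 0" "\<And>r. r \<in> S \<Longrightarrow> \<bar>r - t\<bar> < d1 \<Longrightarrow>
      \<bar>f (fwd_jump S t) - f r - D * (fwd_jump S t - r)\<bar> \<le> e / 2 * \<bar>fwd_jump S t - r\<bar>"
    using assms(1) e unfolding has_delta_derivative_def by metis
  obtain d2 where d2: "d2 > 0" "\<And>r. r \<in> S \<Longrightarrow> \<bar>r - t\<bar> < d2 \<Longrightarrow>
      \<bar>g (fwd_jump S t) - g r - E * (fwd_jump S t - r)\<bar> \<le> e / 2 * \<bar>fwd_jump S t - r\<bar>"
    using assms(2) e unfolding has_delta_derivative_def by metis
  have "\<bar>f (fwd_jump S t) + g (fwd_jump S t) - (f r + g r) - (D + E) * (fwd_jump S t - r)\<bar>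
      \<le> e * \<bar>fwd_jump S t - r\<bar>" if "r \<in> S" "\<bar>r - t\<bar> < min d1 d2" for r
    unfolding distrib_right using d1(2)[of r] d2(2)[of r] that by linarith
  then show "\<exists>d>0. \<forall>r\<in>S. \<bar>r - t\<bar> < d \<longrightarrow>
      \<bar>f (fwd_jump S t) + g (fwd_jump S t) - (f r + g r) - (D + E) * (fwd_jump S t - r)\<bar>
        \<le> e * \<bar>fwd_jump S t - r\<bar>"
    using d1(1) d2(1) by (intro exI[of _ "min d1 d2"]) auto
qed

lemma has_delta_derivative_cmult:
  assumes "has_delta_derivative S f D t"
  shows "has_delta_derivative S (\<lambda>r. c * f r) (c * D) t"
  unfolding has_delta_derivative_def
proof (intro allI impI)
  fix e :: real
  assume e: "e > 0"
  then have "e / (\<bar>c\<bar> + 1) > 0"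
    by (simp add: add_nonneg_pos)
  then obtain d where d: "d > 0" "\<And>r. r \<in> S \<Longrightarrow> \<bar>r - t\<bar> < d \<Longrightarrow>
      \<bar>f (fwd_jump S t) - f r - D * (fwd_jump S t - r)\<bar> \<le> e / (\<bar>c\<bar> + 1) * \<bar>fwd_jump S t - r\<bar>"
    using assms unfolding has_delta_derivative_def by metis
  have "\<bar>c * f (fwd_jump S t) - c * f r - c * D * (fwd_jump S t - r)\<bar> \<le> e * \<bar>fwd_jump S t - r\<bar>"
    if "r \<in> S" "\<bar>r - t\<bar> < d" for r
  proof -
    have "\<bar>c * f (fwd_jump S t) - c * f r - c * D * (fwd_jump S t - r)\<bar>
        = \<bar>c\<bar> * \<bar>f (fwd_jump S t) - f r - D * (fwd_jump S t - r)\<bar>"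
      by (simp add: abs_mult[symmetric] algebra_simps)
    also have "\<dots> \<le> \<bar>c\<bar> * (e / (\<bar>c\<bar> + 1) * \<bar>fwd_jump S t - r\<bar>)"
      using d(2)[OF that] by (intro mult_left_mono) auto
    also have "\<dots> = (\<bar>c\<bar> * (e / (\<bar>c\<bar> + 1))) * \<bar>fwd_jump S t - r\<bar>"
      by simp
    also have "\<dots> \<le> e * \<bar>fwd_jump S t - r\<bar>"
      using e by (intro mult_right_mono) (auto simp: field_simps)
    finally show ?thesis .
  qed
  then show "\<exists>d>0. \<forall>r\<in>S. \<bar>r - t\<bar> < d \<longrightarrow>
      \<bar>c * f (fwd_jump S t) - c * f r - c * D * (fwd_jump S t - r)\<bar> \<le> e * \<bar>fwd_jump S t - r\<bar>"
    using d(1) by blast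
qed

section \<open>Tails of a time scale, induction and monotonicity\<close>

lemma fwd_jump_tail: "s \<le> t \<Longrightarrow> fwd_jump (T \<inter> {s..}) t = fwd_jump T t"
  unfolding fwd_jump_def by (rule arg_cong[of _ _ Inf]) auto

text \<open>Raising the left end only removes points \<open>r\<close> from the estimate and does not
  move the jump. Hence one antiderivative on [t0,\<infinity>) serves every initial point.\<close>

lemma has_delta_derivative_tail:
  assumes "has_delta_derivative (T \<inter> {t0..}) f D t" "t0 \<le> s" "s \<le> t"
  shows "has_delta_derivative (T \<inter> {s..}) f D t"
proof -
  have "fwd_jump (T \<inter> {s..}) t = fwd_jump (T \<inter> {t0..}) t" "T \<inter> {s..} \<subseteq> T \<inter> {t0..}"
    using assms by (auto simp: fwd_jump_tail)
  then show ?thesis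
    using assms(1) unfolding has_delta_derivative_def by (metis subsetD)
qed

text \<open>Let \<open>m\<close> be the infimum of the points with negative \<open>h\<close>. If
  \<open>h m\<close> is nonnegative, such points accumulate at \<open>m\<close> from the right,
  against \<open>dense\<close> or against the gap after \<open>m\<close>. If \<open>h m\<close> is
  negative, then either \<open>m\<close> is a limit of good points, against continuity, or it is the
  jump of a good point, against \<open>scattered\<close>.\<close>

lemma time_scale_nonneg_induct:
  fixes h :: "real \<Rightarrow> real"
  assumes S: "closed S" "\<not> bdd_above S" and ab: "a \<in> S" "b \<in> S" "a \<le> b"
    and cont: "\<And>t. t \<in> S \<Longrightarrow> a \<le> t \<Longrightarrow> t \<le> b \<Longrightarrow> continuous (at t within S) h"
    and base: "0 \<le> h a"
    and scattered: "\<And>t. t \<in> S \<Longrightarrow> a \<le> t \<Longrightarrow> t < b \<Longrightarrow> t < fwd_jump S t \<Longrightarrow>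
      (\<And>r. r \<in> S \<Longrightarrow> a \<le> r \<Longrightarrow> r \<le> t \<Longrightarrow> 0 \<le> h r) \<Longrightarrow> 0 \<le> h (fwd_jump S t)"
    and dense: "\<And>t. t \<in> S \<Longrightarrow> a \<le> t \<Longrightarrow> t < b \<Longrightarrow> fwd_jump S t = t \<Longrightarrow>
      (\<And>r. r \<in> S \<Longrightarrow> a \<le> r \<Longrightarrow> r \<le> t \<Longrightarrow> 0 \<le> h r) \<Longrightarrow>
      \<exists>d>0. \<forall>r\<in>S. t < r \<longrightarrow> r < t + d \<longrightarrow> 0 \<le> h r"
  shows "0 \<le> h b"
proof (rule ccontr)
  assume nb: "\<not> 0 \<le> h b"
  define C where "C = {t \<in> S \<inter> {a..b}. h t < 0}"
  define m where "m = Inf C"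
  have C: "b \<in> C" "bdd_below C" "C \<noteq> {}"
    using nb ab by (auto simp: C_def intro: bdd_belowI[of _ a])
  have "m \<in> closure C"
    unfolding m_def using C by (intro closure_contains_Inf) auto
  also have "closure C \<subseteq> S \<inter> {a..b}"
    using S by (intro closure_minimal) (auto simp: C_def)
  finally have m: "m \<in> S" "a \<le> m" "m \<le> b"
    by auto
  have below: "0 \<le> h r" if "r \<in> S" "a \<le> r" "r < m" for r
  proof (rule ccontr)
    assume "\<not> 0 \<le> h r"
    then have "r \<in> C"
      using that m by (auto simp: C_def)
    then have "m \<le> r"
      unfolding m_def using C by (intro cInf_lower)
    then show False
      using that by simp
  qed
  show False
  proof (cases "0 \<le> h m")
    case True
    then have upto: "0 \<le> h r" if "r \<in> S" "a \<le> r" "r \<le> m" for r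
      using below that by (cases "r = m") auto
    have near: "\<exists>c\<in>C. m < c \<and> c < q" if q: "m < q" for q
    proof -
      obtain c where c: "c \<in> C" "c < q"
        using cInf_lessD[OF C(3), of q] q unfolding m_def by blast
      moreover have "m \<le> c"
        unfolding m_def using c C by (intro cInf_lower)
      moreover have "m \<noteq> c"
        using c True by (auto simp: C_def)
      ultimately show ?thesis
        by (intro bexI[of _ c]) auto
    qed
    have "m < b"
      using near[of "m + 1"] by (auto simp: C_def)
    show False
    proof (cases "fwd_jump S m = m")
      case eq: True
      obtain d where d: "d > 0" "\<forall>r\<in>S. m < r \<longrightarrow> r < m + d \<longrightarrow> 0 \<le> h r"
        using dense[OF m(1,2) \<open>m < b\<close> eq upto] by blast
      then show False
        using near[of "m + d"] by (force simp: C_def)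
    next
      case False
      then have "m < fwd_jump S m"
        using fwd_jump_in[OF S, of m] by simp
      then show False
        using near[of "fwd_jump S m"] fwd_jump_le[of _ S m] by (force simp: C_def)
    qed
  next
    case False
    then have "a < m"
      using base m by (cases "a = m") auto
    show False
    proof (cases "\<forall>e>0. S \<inter> {m - e<..<m} \<noteq> {}")
      case True
      \<comment> \<open>The tolerance \<open>- h m\<close> forces \<open>h\<close> to be negative
        near \<open>m\<close>, while points left of \<open>m\<close> are good.\<close>
      obtain d where d: "d > 0" "\<And>r. r \<in> S \<Longrightarrow> \<bar>r - m\<bar> < d \<Longrightarrow> \<bar>h r - h m\<bar> < - h m"
        using cont[OF m] False unfolding continuous_within_eps_delta dist_real_def
        by (metis neg_0_less_iff_less not_le)
      obtain r where "r \<in> S" "m - d < r" "a < r" "r < m"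
        using True[rule_format, of "min d (m - a)"] d(1) \<open>a < m\<close> by fastforce
      then show False
        using d(2)[of r] below[of r] by auto
    next
      case nonempty: False
      then obtain e where e: "e > 0" "S \<inter> {m - e<..<m} = {}"
        by blast
      have gap: "r \<le> m - e" if "r \<in> S" "r < m" for r
        using e that by (metis disjoint_iff greaterThanLessThan_iff not_le)
      \<comment> \<open>The immediate predecessor of \<open>m\<close> in \<open>S\<close>.\<close>
      define \<rho> where "\<rho> = last_point S (m - e)"
      have \<rho>: "\<rho> \<in> S" "\<rho> < m" "a \<le> \<rho>"
        using last_point_in[OF S(1) ab(1) gap[OF ab(1) \<open>a < m\<close>]]
          last_point_ge[OF ab(1) gap[OF ab(1) \<open>a < m\<close>]] e by (auto simp: \<rho>_def)
      have "fwd_jump S \<rho> = m"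
        unfolding fwd_jump_def
      proof (rule cInf_eq_minimum)
        fix x
        assume x: "x \<in> S \<inter> {\<rho><..}"
        show "m \<le> x"
        proof (rule ccontr)
          assume "\<not> m \<le> x"
          then have "x \<le> \<rho>"
            unfolding \<rho>_def using x gap[of x] by (intro last_point_ge) auto
          then show False
            using x by simp
        qed
      qed (use m \<rho> in auto)
      moreover have "0 \<le> h (fwd_jump S \<rho>)"
        using \<rho> m below calculation by (intro scattered) auto
      ultimately show False
        using False by simp
    qed
  qed
qed

text \<open>At a right-dense point a nonnegative derivative only gives \<open>f r\<close> at least
  \<open>f t - e * (r - t)\<close>. The induction therefore runs with slack
  \<open>e * (t - a)\<close>, and \<open>e\<close> tends to 0 afterwards.\<close>

lemma delta_derivative_nonneg_mono:
  assumes S: "closed S" "\<not> bdd_above S" and ab: "a \<in> S" "b \<in> S" "a \<le> b"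
    and D: "\<And>t. t \<in> S \<Longrightarrow> a \<le> t \<Longrightarrow> t \<le> b \<Longrightarrow> has_delta_derivative S f (D t) t"
    and nonneg: "\<And>t. t \<in> S \<Longrightarrow> a \<le> t \<Longrightarrow> t \<le> b \<Longrightarrow> 0 \<le> D t"
  shows "f a \<le> f b"
proof -
  have slack: "0 \<le> f b - f a + e * (b - a)" if e: "e > 0" for e
  proof (rule time_scale_nonneg_induct[OF S ab, of "\<lambda>t. f t - f a + e * (t - a)"])
    fix t
    assume t: "t \<in> S" "a \<le> t" "t \<le> b"
    show "continuous (at t within S) (\<lambda>t. f t - f a + e * (t - a))"
      using delta_derivative_continuous[OF D[OF t] t(1)] by (intro continuous_intros)
  next
    fix t
    assume t: "t \<in> S" "a \<le> t" "t < b" "t < fwd_jump S t"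
      and IH: "\<And>r. r \<in> S \<Longrightarrow> a \<le> r \<Longrightarrow> r \<le> t \<Longrightarrow> 0 \<le> f r - f a + e * (r - a)"
    have "f (fwd_jump S t) = f t + D t * (fwd_jump S t - t)"
      using t by (intro delta_derivative_jump D) auto
    moreover have "0 \<le> D t * (fwd_jump S t - t)"
      using nonneg[of t] t by simp
    moreover have "e * (t - a) \<le> e * (fwd_jump S t - a)"
      using t e by simp
    ultimately show "0 \<le> f (fwd_jump S t) - f a + e * (fwd_jump S t - a)"
      using IH[of t] t by simp
  next
    fix t
    assume t: "t \<in> S" "a \<le> t" "t < b" "fwd_jump S t = t"
      and IH: "\<And>r. r \<in> S \<Longrightarrow> a \<le> r \<Longrightarrow> r \<le> t \<Longrightarrow> 0 \<le> f r - f a + e * (r - a)"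
    obtain d where d: "d > 0"
      "\<And>r. r \<in> S \<Longrightarrow> t < r \<Longrightarrow> r < t + d \<Longrightarrow> \<bar>f r - f t - D t * (r - t)\<bar> \<le> e * (r - t)"
      using delta_derivative_right_dense[OF D t(4) e] t by (metis less_imp_le)
    have "0 \<le> f r - f a + e * (r - a)" if r: "r \<in> S" "t < r" "r < t + d" for r
    proof -
      have "0 \<le> D t * (r - t)"
        using nonneg[of t] t r by simp
      then have "f t - e * (r - t) \<le> f r"
        using d(2)[OF r] by (simp add: abs_le_iff)
      then show ?thesis
        using IH[of t] t by (simp add: algebra_simps)
    qed
    then show "\<exists>d>0. \<forall>r\<in>S. t < r \<longrightarrow> r < t + d \<longrightarrow> 0 \<le> f r - f a + e * (r - a)"
      using d(1) by blast
  qed simp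
  have "f a \<le> f b + e" if e: "e > 0" for e
  proof -
    have "0 \<le> f b - f a + e / (b - a + 1) * (b - a)"
      using e ab by (intro slack) (simp add: add_nonneg_pos)
    moreover have "e / (b - a + 1) * (b - a) \<le> e"
      using e ab by (simp add: field_simps)
    ultimately show ?thesis
      by simp
  qed
  then show ?thesis
    by (rule field_le_epsilon)
qed

text \<open>Both \<open>K * F + x\<close> and \<open>K * F - x\<close> have nonnegative derivatives,
  so both are monotone.\<close>

lemma delta_mean_value_bound:
  assumes S: "closed S" "\<not> bdd_above S" and ab: "a \<in> S" "b \<in> S" "a \<le> b"
    and x: "\<And>t. t \<in> S \<Longrightarrow> a \<le> t \<Longrightarrow> t \<le> b \<Longrightarrow> has_delta_derivative S x (D t) t"
    and F: "\<And>t. t \<in> S \<Longrightarrow> a \<le> t \<Longrightarrow> t \<le> b \<Longrightarrow> has_delta_derivative S F (A t) t"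
    and bound: "\<And>t. t \<in> S \<Longrightarrow> a \<le> t \<Longrightarrow> t \<le> b \<Longrightarrow> \<bar>D t\<bar> \<le> K * A t"
  shows "\<bar>x b - x a\<bar> \<le> K * (F b - F a)"
proof -
  have mono: "K * F a + c * x a \<le> K * F b + c * x b" if c: "\<bar>c\<bar> = 1" for c
  proof (rule delta_derivative_nonneg_mono[OF S ab, of "\<lambda>t. K * F t + c * x t"])
    fix t
    assume t: "t \<in> S" "a \<le> t" "t \<le> b"
    show "has_delta_derivative S (\<lambda>t. K * F t + c * x t) (K * A t + c * D t) t"
      using x[OF t] F[OF t] by (intro has_delta_derivative_add has_delta_derivative_cmult)
    have "\<bar>c * D t\<bar> \<le> K * A t"
      using bound[OF t] c by (simp add: abs_mult)
    then show "0 \<le> K * A t + c * D t"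
      by linarith
  qed
  show ?thesis
    using mono[of 1] mono[of "-1"] by (simp add: abs_le_iff algebra_simps)
qed

section \<open>The delay equation\<close>

text \<open>
  In the two lemmas below the slack \<open>e\<close> absorbs the error term of the derivative at right-dense points.
\<close>

lemma delay_gronwall:
  assumes S: "closed S" "\<not> bdd_above S" and s: "s \<in> S" "b \<in> S" "s \<le> b"
    and x: "\<And>t. t \<in> S \<Longrightarrow> s \<le> t \<Longrightarrow> has_delta_derivative S x (- (A t * y t)) t"
    and F: "\<And>t. t \<in> S \<Longrightarrow> s \<le> t \<Longrightarrow> has_delta_derivative S F (A t) t"
    and A: "\<And>t. t \<in> S \<Longrightarrow> s \<le> t \<Longrightarrow> 0 \<le> A t"
    and c: "0 < c" "\<bar>x s\<bar> \<le> c" and e: "0 < e"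
    and y: "\<And>t K. t \<in> S \<Longrightarrow> s \<le> t \<Longrightarrow> c \<le> K \<Longrightarrow>
      (\<And>r. r \<in> S \<Longrightarrow> s \<le> r \<Longrightarrow> r \<le> t \<Longrightarrow> \<bar>x r\<bar> \<le> K) \<Longrightarrow> \<bar>y t\<bar> \<le> K"
  shows "\<bar>x b\<bar> \<le> c * exp (F b - F s + e * (b - s))"
proof -
  \<comment> \<open>A strict exponential majorant of \<open>\<bar>x\<bar>\<close>: the
    \<open>F\<close> part dominates the equation, the \<open>e\<close> part pays for errors.\<close>
  define B where "B = (\<lambda>t. c * exp (F t - F s + e * (t - s)))"
  have B_pos: "B t > 0" for t
    using c by (simp add: B_def)
  have F_mono: "F r \<le> F t" if "r \<in> S" "t \<in> S" "s \<le> r" "r \<le> t" for r t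
    using delta_derivative_nonneg_mono[OF S, of r t F A] F A that by auto
  have B_mono: "B r \<le> B t" if "r \<in> S" "t \<in> S" "s \<le> r" "r \<le> t" for r t
    using F_mono[OF that] e c that unfolding B_def by (auto intro!: add_mono)
  have "B s = c"
    by (simp add: B_def)
  \<comment> \<open>By 1 + z \<le> exp z, \<open>B\<close> dominates both the exact factor of a jump
    and the first-order growth at a right-dense point.\<close>
  have B_growth: "B t * (1 + (F r - F t) + e * (r - t)) \<le> B r" for r t
  proof -
    have "B r = B t * exp ((F r - F t) + e * (r - t))"
      by (simp add: B_def exp_add exp_diff algebra_simps)
    moreover have "1 + (F r - F t) + e * (r - t) \<le> exp ((F r - F t) + e * (r - t))"
      using exp_ge_add_one_self[of "(F r - F t) + e * (r - t)"] by linarith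
    ultimately show ?thesis
      using B_pos[of t] by simp
  qed
  \<comment> \<open>Here \<open>y t\<close> stands for the delayed value. As \<open>B\<close> is
    increasing, \<open>B t\<close> bounds the whole past and can serve as the \<open>K\<close> of
    the hypothesis on \<open>y\<close>.\<close>
  have hist: "\<bar>x t\<bar> \<le> B t \<and> \<bar>y t\<bar> \<le> B t"
    if t: "t \<in> S" "s \<le> t"
      and IH: "\<And>r. r \<in> S \<Longrightarrow> s \<le> r \<Longrightarrow> r \<le> t \<Longrightarrow> 0 \<le> B r - \<bar>x r\<bar>" for t
  proof
    show "\<bar>x t\<bar> \<le> B t"
      using IH[of t] t by simp
    have "c \<le> B t"
      using B_mono[OF s(1) t(1) _ t(2)] \<open>B s = c\<close> by simp
    moreover have "\<bar>x r\<bar> \<le> B t" if "r \<in> S" "s \<le> r" "r \<le> t" for r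
      using IH[OF that] B_mono[of r t] that t by force
    ultimately show "\<bar>y t\<bar> \<le> B t"
      by (rule y[OF t])
  qed
  have "0 \<le> B b - \<bar>x b\<bar>"
  proof (rule time_scale_nonneg_induct[OF S s])
    fix t
    assume t: "t \<in> S" "s \<le> t" "t \<le> b"
    show "continuous (at t within S) (\<lambda>t. B t - \<bar>x t\<bar>)"
      using delta_derivative_continuous[OF x[OF t(1,2)] t(1)]
        delta_derivative_continuous[OF F[OF t(1,2)] t(1)]
      unfolding B_def by (intro continuous_intros)
  next
    fix t
    assume t: "t \<in> S" "s \<le> t" "t < b" "t < fwd_jump S t"
      and IH: "\<And>r. r \<in> S \<Longrightarrow> s \<le> r \<Longrightarrow> r \<le> t \<Longrightarrow> 0 \<le> B r - \<bar>x r\<bar>"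
    let ?\<mu> = "fwd_jump S t - t"
    have "\<bar>x t - A t * ?\<mu> * y t\<bar> \<le> \<bar>x t\<bar> + A t * ?\<mu> * \<bar>y t\<bar>"
      using A[OF t(1,2)] t(4) abs_triangle_ineq4[of "x t" "A t * ?\<mu> * y t"] by (simp add: abs_mult)
    also have "\<dots> \<le> B t + A t * ?\<mu> * B t"
      using hist[OF t(1,2) IH] A[OF t(1,2)] t(4) by (intro add_mono mult_left_mono) auto
    also have "\<dots> = B t * (1 + (F (fwd_jump S t) - F t))"
    proof -
      have "F (fwd_jump S t) - F t = A t * ?\<mu>"
        using delta_derivative_jump[OF F[OF t(1,2)] t(1)] by simp
      then show ?thesis
        by (simp only:) (simp add: algebra_simps)
    qed
    also have "\<dots> \<le> B t * (1 + (F (fwd_jump S t) - F t) + e * ?\<mu>)"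
      using B_pos[of t] e t(4) by (intro mult_left_mono) auto
    also have "\<dots> \<le> B (fwd_jump S t)"
      by (rule B_growth)
    finally show "0 \<le> B (fwd_jump S t) - \<bar>x (fwd_jump S t)\<bar>"
      using delta_derivative_jump[OF x[OF t(1,2)] t(1)] by (simp add: algebra_simps)
  next
    fix t
    assume t: "t \<in> S" "s \<le> t" "t < b" "fwd_jump S t = t"
      and IH: "\<And>r. r \<in> S \<Longrightarrow> s \<le> r \<Longrightarrow> r \<le> t \<Longrightarrow> 0 \<le> B r - \<bar>x r\<bar>"
    \<comment> \<open>Half of the slack pays for the error of \<open>x\<close>, scaled by
      \<open>B t\<close> so that it factors out; the other half pays for the error of
      \<open>F\<close>.\<close>
    obtain d1 where d1: "d1 > 0" "\<And>r. r \<in> S \<Longrightarrow> t < r \<Longrightarrow> r < t + d1 \<Longrightarrow>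
        \<bar>x r - x t - (- (A t * y t)) * (r - t)\<bar> \<le> (B t * (e / 2)) * (r - t)"
      using delta_derivative_right_dense[OF x[OF t(1,2)] t(4), of "B t * (e / 2)"] B_pos[of t] e
      by auto
    obtain d2 where d2: "d2 > 0" "\<And>r. r \<in> S \<Longrightarrow> t < r \<Longrightarrow> r < t + d2 \<Longrightarrow>
        \<bar>F r - F t - A t * (r - t)\<bar> \<le> (e / 2) * (r - t)"
      using delta_derivative_right_dense[OF F[OF t(1,2)] t(4), of "e / 2"] e by auto
    have "0 \<le> B r - \<bar>x r\<bar>" if r: "r \<in> S" "t < r" "r < t + min d1 d2" for r
    proof -
      have near_x: "\<bar>x r - x t + A t * y t * (r - t)\<bar> \<le> (B t * (e / 2)) * (r - t)"
        using d1(2)[of r] r by simp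
      have "\<bar>A t * y t * (r - t)\<bar> = A t * (r - t) * \<bar>y t\<bar>"
        using A[OF t(1,2)] r by (simp add: abs_mult)
      also have "\<dots> \<le> A t * (r - t) * B t"
        using hist[OF t(1,2) IH] A[OF t(1,2)] r by (intro mult_left_mono) auto
      finally have "\<bar>x r\<bar> \<le> B t + A t * (r - t) * B t + (B t * (e / 2)) * (r - t)"
        using near_x hist[OF t(1,2) IH] by linarith
      also have "\<dots> = B t * (1 + (A t * (r - t) - (e / 2) * (r - t)) + e * (r - t))"
        by (simp add: field_simps)
      also have "\<dots> \<le> B t * (1 + (F r - F t) + e * (r - t))"
      proof (rule mult_left_mono)
        have "\<bar>F r - F t - A t * (r - t)\<bar> \<le> (e / 2) * (r - t)"
          using d2(2)[of r] r by simp
        then show "1 + (A t * (r - t) - (e / 2) * (r - t)) + e * (r - t)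
            \<le> 1 + (F r - F t) + e * (r - t)"
          by linarith
      qed (use B_pos[of t] in simp)
      also have "\<dots> \<le> B r"
        by (rule B_growth)
      finally show ?thesis
        by simp
    qed
    then show "\<exists>d>0. \<forall>r\<in>S. t < r \<longrightarrow> r < t + d \<longrightarrow> 0 \<le> B r - \<bar>x r\<bar>"
      using d1(1) d2(1) by (intro exI[of _ "min d1 d2"]) auto
  qed (use c \<open>B s = c\<close> in auto)
  then show ?thesis
    by (simp add: B_def)
qed

lemma delay_trapping:
  assumes S: "closed S" "\<not> bdd_above S" and a: "a \<in> S" "b \<in> S" "a \<le> b"
    and x: "\<And>t. t \<in> S \<Longrightarrow> a \<le> t \<Longrightarrow> has_delta_derivative S x (- (A t * y t)) t"
    and A: "\<And>t. t \<in> S \<Longrightarrow> a \<le> t \<Longrightarrow> 0 \<le> A t"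
    and jump: "\<And>t. t \<in> S \<Longrightarrow> a \<le> t \<Longrightarrow> t < fwd_jump S t \<Longrightarrow> A t * (fwd_jump S t - t) \<le> 1"
    and B: "\<bar>x a\<bar> \<le> B" and e: "0 < e"
    and step: "\<And>t K h. t \<in> S \<Longrightarrow> a \<le> t \<Longrightarrow> B \<le> K \<Longrightarrow>
      (\<And>r. r \<in> S \<Longrightarrow> a \<le> r \<Longrightarrow> r \<le> t \<Longrightarrow> \<bar>x r\<bar> \<le> K) \<Longrightarrow> 0 \<le> h \<Longrightarrow> h \<le> 1 \<Longrightarrow> \<bar>x t - h * y t\<bar> \<le> K"
  shows "\<bar>x b\<bar> \<le> B + e * (b - a)"
proof -
  \<comment> \<open>A barrier rising with slope \<open>e\<close>: jumps preserve the bound exactly,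
    and the rise absorbs the error at right-dense points.\<close>
  define K where "K = (\<lambda>t. B + e * (t - a))"
  have K_mono: "K r \<le> K t" if "r \<le> t" for r t
    using that e by (simp add: K_def)
  have K_step: "\<bar>x t - h * y t\<bar> \<le> K t"
    if t: "t \<in> S" "a \<le> t" and h: "0 \<le> h" "h \<le> 1"
      and IH: "\<And>r. r \<in> S \<Longrightarrow> a \<le> r \<Longrightarrow> r \<le> t \<Longrightarrow> 0 \<le> K r - \<bar>x r\<bar>" for t h
  proof (rule step[OF t _ _ h])
    show "B \<le> K t"
      using t e by (simp add: K_def)
    show "\<bar>x r\<bar> \<le> K t" if "r \<in> S" "a \<le> r" "r \<le> t" for r
      using IH[OF that] K_mono[OF that(3)] by simp
  qed
  have "0 \<le> K b - \<bar>x b\<bar>"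
  proof (rule time_scale_nonneg_induct[OF S a])
    fix t
    assume t: "t \<in> S" "a \<le> t" "t \<le> b"
    show "continuous (at t within S) (\<lambda>t. K t - \<bar>x t\<bar>)"
      using delta_derivative_continuous[OF x[OF t(1,2)] t(1)]
      unfolding K_def by (intro continuous_intros)
  next
    fix t
    assume t: "t \<in> S" "a \<le> t" "t < b" "t < fwd_jump S t"
      and IH: "\<And>r. r \<in> S \<Longrightarrow> a \<le> r \<Longrightarrow> r \<le> t \<Longrightarrow> 0 \<le> K r - \<bar>x r\<bar>"
    have "\<bar>x t - A t * (fwd_jump S t - t) * y t\<bar> \<le> K t"
      using A[OF t(1,2)] jump[OF t(1,2,4)] t(4) by (intro K_step[OF t(1,2) _ _ IH]) auto
    also have "\<dots> \<le> K (fwd_jump S t)"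
      using t by (intro K_mono) simp
    finally show "0 \<le> K (fwd_jump S t) - \<bar>x (fwd_jump S t)\<bar>"
      using delta_derivative_jump[OF x[OF t(1,2)] t(1)] by (simp add: algebra_simps)
  next
    fix t
    assume t: "t \<in> S" "a \<le> t" "t < b" "fwd_jump S t = t"
      and IH: "\<And>r. r \<in> S \<Longrightarrow> a \<le> r \<Longrightarrow> r \<le> t \<Longrightarrow> 0 \<le> K r - \<bar>x r\<bar>"
    obtain d where d: "d > 0" "\<And>r. r \<in> S \<Longrightarrow> t < r \<Longrightarrow> r < t + d \<Longrightarrow>
        \<bar>x r - x t - (- (A t * y t)) * (r - t)\<bar> \<le> e * (r - t)"
      using delta_derivative_right_dense[OF x[OF t(1,2)] t(4) e] by auto
    \<comment> \<open>The second term ensures that \<open>h = A t * (r - t)\<close> is at most 1, as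
      \<open>step\<close> requires.\<close>
    define d' where "d' = min d (1 / (A t + 1))"
    have "d' > 0"
      using d A[OF t(1,2)] by (simp add: d'_def add_nonneg_pos)
    moreover have "0 \<le> K r - \<bar>x r\<bar>" if r: "r \<in> S" "t < r" "r < t + d'" for r
    proof -
      have "A t * (r - t) \<le> (A t + 1) * (r - t)"
        using r by (intro mult_right_mono) auto
      also have "\<dots> \<le> (A t + 1) * (1 / (A t + 1))"
        using A[OF t(1,2)] r by (intro mult_left_mono) (auto simp: d'_def)
      also have "\<dots> = 1"
        using A[OF t(1,2)] by simp
      finally have "\<bar>x t - A t * (r - t) * y t\<bar> \<le> K t"
        using A[OF t(1,2)] r by (intro K_step[OF t(1,2) _ _ IH]) auto
      moreover have "\<bar>x r - (x t - A t * (r - t) * y t)\<bar> \<le> e * (r - t)"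
        using d(2)[of r] r by (simp add: d'_def algebra_simps)
      moreover have "K r = K t + e * (r - t)"
        by (simp add: K_def algebra_simps)
      ultimately show ?thesis
        by linarith
    qed
    ultimately show "\<exists>d>0. \<forall>r\<in>S. t < r \<longrightarrow> r < t + d \<longrightarrow> 0 \<le> K r - \<bar>x r\<bar>"
      by blast
  qed (use B in \<open>simp add: K_def\<close>)
  then show ?thesis
    by (simp add: K_def)
qed

section \<open>Properties of the delay functions\<close>

lemma alpha_bdd_below:
  assumes "closed T" "rd_continuous (T \<inter> {t0..}) \<alpha>"
    and lim: "filterlim \<alpha> at_top (inf at_top (principal (T \<inter> {t0..})))"
    and "t0 \<le> s"
  shows "bdd_below (\<alpha> ` (T \<inter> {s..}))"
proof -
  \<comment> \<open>Beyond some \<open>N\<close> the limit bounds \<open>\<alpha>\<close> below; up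
    to \<open>N\<close> rd-continuity does.\<close>
  have "\<forall>\<^sub>F t in inf at_top (principal (T \<inter> {t0..})). 0 \<le> \<alpha> t"
    using lim unfolding filterlim_at_top by blast
  then obtain N where N: "\<And>t. N \<le> t \<Longrightarrow> t \<in> T \<inter> {t0..} \<Longrightarrow> 0 \<le> \<alpha> t"
    unfolding eventually_inf_principal eventually_at_top_linorder by blast
  obtain K where K: "\<And>t. t \<in> T \<inter> {t0..} \<inter> {t0..N} \<Longrightarrow> \<bar>\<alpha> t\<bar> \<le> K"
    using rd_continuous_bounded[OF closed_Int[OF assms(1) closed_atLeast] assms(2), of t0 N] by blast
  have "min 0 (- K) \<le> \<alpha> t" if "t \<in> T \<inter> {s..}" for t
    using N[of t] K[of t] that \<open>t0 \<le> s\<close> by (cases "N \<le> t") auto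
  then show ?thesis
    by (intro bdd_belowI2)
qed

text \<open>The set \<open>Y\<close> contains \<open>s\<close>, since \<alpha>(s) \<le> s, and is
  bounded because \<alpha> tends to infinity. Its supremum is thus genuine and lies in the closed
  set \<open>T\<close>; points beyond it are not in \<open>Y\<close>, so even the infimum of later
  values of \<alpha> exceeds \<open>s\<close>.\<close>

lemma alpha_minus1_props:
  assumes T: "closed T"
    and bdd: "\<And>s. t0 \<le> s \<Longrightarrow> bdd_below (\<alpha> ` (T \<inter> {s..}))"
    and lim: "filterlim \<alpha> at_top (inf at_top (principal (T \<inter> {t0..})))"
    and delay: "\<forall>t \<in> T \<inter> {t0..}. \<alpha> t \<le> t"
    and s: "s \<in> T" "t0 \<le> s"
  shows "alpha_minus1 T t0 \<alpha> s \<in> T" "s \<le> alpha_minus1 T t0 \<alpha> s"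
    and "\<And>t. t \<in> T \<Longrightarrow> alpha_minus1 T t0 \<alpha> s < t \<Longrightarrow> s < \<alpha> t"
proof -
  define Y where "Y = {\<eta> \<in> T \<inter> {t0..}. alpha_star T \<alpha> \<eta> \<le> s}"
  define a where "a = alpha_minus1 T t0 \<alpha> s"
  have a: "a = Sup Y"
    by (simp add: a_def Y_def alpha_minus1_def)
  have star_le: "alpha_star T \<alpha> t \<le> \<alpha> t" if "t \<in> T" "t0 \<le> t" for t
    unfolding alpha_star_def using that bdd by (intro cInf_lower) auto
  have sY: "s \<in> Y"
    using star_le[OF s] delay s by (force simp: Y_def)
  \<comment> \<open>The margin 1 keeps the infimum \<open>alpha_star\<close> strictly above
    \<open>s\<close>.\<close>
  have "\<forall>\<^sub>F t in inf at_top (principal (T \<inter> {t0..})). s + 1 \<le> \<alpha> t"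
    using lim unfolding filterlim_at_top by blast
  then obtain N where N: "\<And>t. N \<le> t \<Longrightarrow> t \<in> T \<inter> {t0..} \<Longrightarrow> s + 1 \<le> \<alpha> t"
    unfolding eventually_inf_principal eventually_at_top_linorder by blast
  have "\<eta> \<le> N" if "\<eta> \<in> Y" for \<eta>
  proof (rule ccontr)
    assume "\<not> \<eta> \<le> N"
    then have "s + 1 \<le> alpha_star T \<alpha> \<eta>"
      unfolding alpha_star_def using that N by (intro cInf_greatest) (auto simp: Y_def)
    then show False
      using that by (simp add: Y_def)
  qed
  then have Y_bdd: "bdd_above Y"
    by (rule bdd_aboveI)
  have "a \<in> closure Y"
    unfolding a using sY Y_bdd by (intro closure_contains_Sup) auto
  also have "closure Y \<subseteq> T"
    using T by (intro closure_minimal) (auto simp: Y_def)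
  finally show "alpha_minus1 T t0 \<alpha> s \<in> T"
    by (simp add: a_def)
  show sa: "s \<le> alpha_minus1 T t0 \<alpha> s"
    using cSup_upper[OF sY Y_bdd] by (simp add: a a_def[symmetric])
  fix t
  assume t: "t \<in> T" "alpha_minus1 T t0 \<alpha> s < t"
  then have "t \<notin> Y"
    using cSup_upper[OF _ Y_bdd, of t] by (force simp: a a_def[symmetric])
  then have "s < alpha_star T \<alpha> t"
    using t s sa by (auto simp: Y_def)
  then show "s < \<alpha> t"
    using star_le[of t] t s sa by simp
qed

lemma ennreal_history_bound:
  assumes "ennreal \<bar>c\<bar> + (SUP \<eta>\<in>H. ennreal \<bar>f \<eta>\<bar>) < ennreal \<delta>" "0 < \<delta>"
  shows "\<bar>c\<bar> < \<delta>" "\<eta> \<in> H \<Longrightarrow> \<bar>f \<eta>\<bar> < \<delta>"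
proof -
  have "ennreal \<bar>c\<bar> \<le> ennreal \<bar>c\<bar> + (SUP \<eta>\<in>H. ennreal \<bar>f \<eta>\<bar>)"
    by (rule le_iff_add[THEN iffD2]) blast
  then have "ennreal \<bar>c\<bar> < ennreal \<delta>"
    using assms(1) by (rule le_less_trans)
  then show "\<bar>c\<bar> < \<delta>"
    by (simp add: ennreal_less_iff)
  assume "\<eta> \<in> H"
  then have "ennreal \<bar>f \<eta>\<bar> \<le> (SUP \<eta>\<in>H. ennreal \<bar>f \<eta>\<bar>)"
    by (rule SUP_upper)
  also have "\<dots> \<le> ennreal \<bar>c\<bar> + (SUP \<eta>\<in>H. ennreal \<bar>f \<eta>\<bar>)"
    using add_increasing[of "ennreal \<bar>c\<bar>"] by simp
  also have "\<dots> < ennreal \<delta>"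
    by (rule assms(1))
  finally show "\<bar>f \<eta>\<bar> < \<delta>"
    by (simp add: ennreal_less_iff)
qed

section \<open>Uniform stability\<close>

theorem theorem4p4:
  fixes T :: "real set" and t0 :: real and A \<alpha> :: "real \<Rightarrow> real"
  assumes "time_scale T" and "\<not> bdd_above T" and "t0 \<in> T"
    and "rd_continuous (T \<inter> {t0..}) A"
    and "\<forall>t \<in> T \<inter> {t0..}. A t \<ge> 0"
    and "rd_continuous (T \<inter> {t0..}) \<alpha>"
    and "\<forall>t \<in> T \<inter> {t0..}. \<alpha> t \<in> T"
    and delay: "\<forall>t \<in> T \<inter> {t0..}. \<alpha> t \<le> t"
    and "filterlim \<alpha> at_top (inf at_top (principal (T \<inter> {t0..})))"
    and "\<forall>t \<in> T \<inter> {t0..}. \<alpha> (fwd_jump T t) \<le> t"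
    and "(SUP s \<in> T \<inter> {t0..}.
            ereal (delta_integral (T \<inter> {t0..}) A s (alpha_minus1 T t0 \<alpha> s))) < \<infinity>"
    and "\<forall>t \<in> T \<inter> {t0..}. \<alpha> t \<ge> t0 \<longrightarrow> delta_integral (T \<inter> {t0..}) A (\<alpha> t) t \<le> 1"
  shows "uniformly_stable T t0 A \<alpha>"
proof -
  have T: "closed T"
    using assms(1) by (simp add: time_scale_def)
  have tail: "closed (T \<inter> {s..})" "\<not> bdd_above (T \<inter> {s..})" for s
  proof -
    show "closed (T \<inter> {s..})"
      using T by auto
    have "T \<subseteq> (T \<inter> {s..}) \<union> {..s}"
      by auto
    then show "\<not> bdd_above (T \<inter> {s..})"
      using assms(2) bdd_above_mono[of "(T \<inter> {s..}) \<union> {..s}" T] by auto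
  qed
  \<comment> \<open>The same choice as in \<open>delta_integral\<close>, so integrals are
    differences of \<open>F\<close> by definition.\<close>
  define F where "F = (SOME F. delta_antiderivative (T \<inter> {t0..}) A F)"
  have ex: "\<exists>F. delta_antiderivative (T \<inter> {t0..}) A F"
    using tail[of t0] assms(3,4) by (intro delta_antiderivative_exists) auto
  have "delta_antiderivative (T \<inter> {t0..}) A F"
    using someI_ex[OF ex] by (simp only: F_def)
  then have F0: "has_delta_derivative (T \<inter> {t0..}) F (A t) t" if "t \<in> T" "t0 \<le> t" for t
    using that by (simp add: delta_antiderivative_def)
  have F: "has_delta_derivative (T \<inter> {s..}) F (A t) t" if "t \<in> T" "t0 \<le> s" "s \<le> t" for s t
    using that by (intro has_delta_derivative_tail[OF F0]) auto
  have integral: "delta_integral (T \<inter> {t0..}) A p q = F q - F p" for p q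
    by (simp add: delta_integral_def F_def Let_def)
  have A: "0 \<le> A t" if "t \<in> T" "t0 \<le> t" for t
    using assms(5) that by blast
  have F_mono: "F p \<le> F q" if "p \<in> T" "q \<in> T" "t0 \<le> p" "p \<le> q" for p q
    using that F A by (intro delta_derivative_nonneg_mono[OF tail[of t0], of p q F A]) auto
  have delay_int: "F t - F (\<alpha> t) \<le> 1" if "t \<in> T" "t0 \<le> \<alpha> t" "t0 \<le> t" for t
    using assms(12) that by (auto simp: integral)
  have bdd: "bdd_below (\<alpha> ` (T \<inter> {s..}))" if "t0 \<le> s" for s
    using alpha_bdd_below[OF T assms(6,9) that] .
  note am1 = alpha_minus1_props[OF T bdd assms(9) delay]
  define X where
    "X = (SUP s \<in> T \<inter> {t0..}. ereal (delta_integral (T \<inter> {t0..}) A s (alpha_minus1 T t0 \<alpha> s)))"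
  have "X < \<infinity>"
    using assms(11) by (simp add: X_def)
  then have "\<exists>M. X \<le> ereal M"
    by (cases X) auto
  then obtain M where "X \<le> ereal M"
    by blast
  then have M: "F (alpha_minus1 T t0 \<alpha> s) - F s \<le> M" if "s \<in> T" "t0 \<le> s" for s
    using that by (auto simp: X_def SUP_le_iff integral)
  show ?thesis
    unfolding uniformly_stable_def
  proof (intro allI impI)
    fix \<epsilon> :: real
    assume \<epsilon>: "\<epsilon> > 0"
    \<comment> \<open>On [s,a] the Gronwall bound is \<open>\<delta> * exp (M + 1)\<close>, that is
      \<epsilon>/4, the 1 covering its slack. Leaving \<open>a\<close> costs a factor 2, and the
      slack afterwards another \<epsilon>/4, for a total of 3\<epsilon>/4.\<close>
    define \<delta> where "\<delta> = \<epsilon> / 4 / exp (M + 1)"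
    have \<delta>: "\<delta> > 0"
      using \<epsilon> by (simp add: \<delta>_def)
    have "\<bar>x t\<bar> < \<epsilon>"
      if s: "s \<in> T" "t0 \<le> s" and sol: "ivp_solution T A \<alpha> s x0 \<phi> x"
        and small: "ennreal \<bar>x0\<bar> + (SUP \<eta> \<in> T \<inter> {alpha_star T \<alpha> s..<s}. ennreal \<bar>\<phi> \<eta>\<bar>) < ennreal \<delta>"
        and t: "t \<in> T" "s \<le> t" for s x0 \<phi> x t
    proof -
      define a where "a = alpha_minus1 T t0 \<alpha> s"
      have a: "a \<in> T" "s \<le> a" and late: "\<And>r. r \<in> T \<Longrightarrow> a < r \<Longrightarrow> s < \<alpha> r"
        using am1[OF _ s] by (auto simp: a_def)
      obtain D where D: "\<And>r. r \<in> T \<Longrightarrow> s \<le> r \<Longrightarrow> has_delta_derivative (T \<inter> {s..}) x (D r) r"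
        "\<And>r. r \<in> T \<Longrightarrow> s \<le> r \<Longrightarrow> D r = - (A r * x (\<alpha> r))"
        using sol unfolding ivp_solution_def by (auto simp: add_eq_0_iff2)
      have x: "has_delta_derivative (T \<inter> {s..}) x (- (A r * x (\<alpha> r))) r" if "r \<in> T" "s \<le> r" for r
        using D[OF that] by simp
      have x_s: "\<bar>x s\<bar> \<le> \<delta>"
        using sol ennreal_history_bound(1)[OF small \<delta>] by (simp add: ivp_solution_def)
      have x_hist: "\<bar>x r\<bar> \<le> \<delta>" if "r \<in> T" "alpha_star T \<alpha> s \<le> r" "r < s" for r
        using sol ennreal_history_bound(2)[OF small \<delta>, of r] that
        by (auto simp: ivp_solution_def less_imp_le)
      \<comment> \<open>The delayed argument lies either in the history interval, where \<delta>
        bounds \<open>x\<close>, or in [s,r], where \<open>K\<close> does.\<close>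
      have y: "\<bar>x (\<alpha> r)\<bar> \<le> K"
        if r: "r \<in> T" "s \<le> r" and "\<delta> \<le> K"
          and K: "\<And>q. q \<in> T \<Longrightarrow> s \<le> q \<Longrightarrow> q \<le> r \<Longrightarrow> \<bar>x q\<bar> \<le> K" for r K
      proof -
        have "alpha_star T \<alpha> s \<le> \<alpha> r"
          unfolding alpha_star_def using r s bdd by (intro cInf_lower) auto
        moreover have "\<alpha> r \<in> T" "\<alpha> r \<le> r"
          using r s assms(7) delay by auto
        ultimately show ?thesis
          using x_hist[of "\<alpha> r"] K[of "\<alpha> r"] \<open>\<delta> \<le> K\<close> by (cases "\<alpha> r < s") auto
      qed
      have phase1: "\<bar>x r\<bar> \<le> \<epsilon> / 4" if r: "r \<in> T" "s \<le> r" "r \<le> a" for r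
      proof -
        \<comment> \<open>Chosen so that the accumulated slack is at most 1 for any length of the
          interval.\<close>
        define e where "e = 1 / (r - s + 1)"
        have e: "e > 0" "e * (r - s) \<le> 1"
          using r by (auto simp: e_def field_simps)
        have "\<bar>x r\<bar> \<le> \<delta> * exp (F r - F s + e * (r - s))"
        proof (rule delay_gronwall[OF tail[of s], where A = A and y = "\<lambda>r. x (\<alpha> r)"])
          show "\<bar>x (\<alpha> q)\<bar> \<le> K" if "q \<in> T \<inter> {s..}" "\<delta> \<le> K"
            "\<And>r. r \<in> T \<inter> {s..} \<Longrightarrow> s \<le> r \<Longrightarrow> r \<le> q \<Longrightarrow> \<bar>x r\<bar> \<le> K" for q K
            using that by (intro y[of q]) auto
        qed (use s r x F A \<delta> x_s e in auto)
        also have "\<dots> \<le> \<delta> * exp (M + 1)"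
          using F_mono[of r a] M[OF s] r a s e \<delta> by (simp add: a_def)
        also have "\<dots> = \<epsilon> / 4"
          by (simp add: \<delta>_def)
        finally show ?thesis .
      qed
      have "M \<ge> 0"
        using F_mono[of s a] M[OF s] s a by (simp add: a_def)
      then have "\<delta> \<le> \<epsilon> / 4"
        using \<epsilon> by (simp add: \<delta>_def field_simps)
      show ?thesis
      proof (cases "t \<le> a")
        case True
        then show ?thesis
          using phase1[OF t] \<epsilon> by simp
      next
        case False
        \<comment> \<open>The slack adds up to exactly \<epsilon>/4 at the fixed target
          \<open>t\<close>.\<close>
        define e where "e = \<epsilon> / 4 / (t - a)"
        have e: "e > 0" "e * (t - a) = \<epsilon> / 4"
          using False \<epsilon> nonzero_eq_divide_eq[THEN iffD1, OF _ e_def] by (auto simp: e_def)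
        have "\<bar>x t\<bar> \<le> \<epsilon> / 2 + e * (t - a)"
        proof (rule delay_trapping[OF tail[of s], where A = A and y = "\<lambda>r. x (\<alpha> r)"])
          fix r
          assume r: "r \<in> T \<inter> {s..}" "a \<le> r" "r < fwd_jump (T \<inter> {s..}) r"
          \<comment> \<open>Even when \<open>r = a\<close>, the point \<open>q\<close> lies beyond
            \<open>a\<close>, so \<open>late\<close> gives s < \<alpha>(q) and the window from
            \<alpha>(q) to \<open>q\<close> contains [r,q].\<close>
          define q where "q = fwd_jump T r"
          have q: "r < q" "q = fwd_jump (T \<inter> {s..}) r"
            using r by (auto simp: q_def fwd_jump_tail)
          have "q \<in> T"
            using fwd_jump_in[OF tail[of s], of r] q by simp
          have \<alpha>q: "\<alpha> q \<in> T" "\<alpha> q \<le> r"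
            using assms(7,10) \<open>q \<in> T\<close> r s a q(1) by (auto simp: q_def)
          have "A r * (q - r) = F q - F r"
            using delta_derivative_jump[OF F, of r s] r s q by simp
          also have "\<dots> \<le> F q - F (\<alpha> q)"
            using F_mono[of "\<alpha> q" r] \<alpha>q late[OF \<open>q \<in> T\<close>] r s a q by simp
          also have "\<dots> \<le> 1"
            using late[OF \<open>q \<in> T\<close>] \<open>q \<in> T\<close> r s a q by (intro delay_int) auto
          finally show "A r * (fwd_jump (T \<inter> {s..}) r - r) \<le> 1"
            using q by simp
        next
          fix r K h
          assume r: "r \<in> T \<inter> {s..}" "a \<le> r" and K: "\<epsilon> / 2 \<le> K"
            and IH: "\<And>q. q \<in> T \<inter> {s..} \<Longrightarrow> a \<le> q \<Longrightarrow> q \<le> r \<Longrightarrow> \<bar>x q\<bar> \<le> K"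
            and h: "0 \<le> (h::real)" "h \<le> 1"
          \<comment> \<open>The first phase extends the bound from [a,r] back to [s,r].\<close>
          have upto: "\<bar>x q\<bar> \<le> K" if "q \<in> T" "s \<le> q" "q \<le> r" for q
            using IH[of q] phase1[of q] that K \<epsilon> by (cases "a \<le> q") auto
          show "\<bar>x r - h * x (\<alpha> r)\<bar> \<le> K"
          proof (cases "r = a")
            case True
            have "\<bar>x (\<alpha> a)\<bar> \<le> \<epsilon> / 4"
              using a phase1 \<open>\<delta> \<le> \<epsilon> / 4\<close> by (intro y) auto
            then have "h * \<bar>x (\<alpha> a)\<bar> \<le> \<epsilon> / 4"
              using mult_mono[OF h(2), of "\<bar>x (\<alpha> a)\<bar>" "\<epsilon> / 4"] h by simp
            then show ?thesis
              using True phase1[OF a] K abs_triangle_ineq4[of "x a" "h * x (\<alpha> a)"] h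
              by (simp add: abs_mult)
          next
            case False
            then have \<alpha>r: "s < \<alpha> r" "\<alpha> r \<in> T" "\<alpha> r \<le> r"
              using late[of r] r s assms(7) delay by auto
            \<comment> \<open>The whole interval from \<alpha>(r) to \<open>r\<close> lies in [s,r],
              so the equation holds on it and \<open>y\<close> bounds every delayed value by
              \<open>K\<close>.\<close>
            have "\<bar>x r - x (\<alpha> r)\<bar> \<le> K * (F r - F (\<alpha> r))"
            proof (rule delta_mean_value_bound[OF tail[of s]])
              fix q
              assume q: "q \<in> T \<inter> {s..}" "\<alpha> r \<le> q" "q \<le> r"
              have "\<bar>x (\<alpha> q)\<bar> \<le> K"
                using q K \<open>\<delta> \<le> \<epsilon> / 4\<close> \<epsilon> upto by (intro y) auto
              then have "A q * \<bar>x (\<alpha> q)\<bar> \<le> A q * K"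
                using A[of q] q s by (intro mult_left_mono) auto
              then show "\<bar>- (A q * x (\<alpha> q))\<bar> \<le> K * A q"
                using A[of q] q s by (simp add: abs_mult mult.commute)
            qed (use r \<alpha>r x F s in auto)
            also have "\<dots> \<le> K * 1"
              using delay_int[of r] r s \<alpha>r K \<epsilon> by (intro mult_left_mono) auto
            finally have diff: "\<bar>x r - x (\<alpha> r)\<bar> \<le> K"
              by simp
            \<comment> \<open>A convex combination of two quantities bounded by
              \<open>K\<close>.\<close>
            have "x r - h * x (\<alpha> r) = (1 - h) * x r + h * (x r - x (\<alpha> r))"
              by (simp add: algebra_simps)
            also have "\<bar>\<dots>\<bar> \<le> (1 - h) * \<bar>x r\<bar> + h * \<bar>x r - x (\<alpha> r)\<bar>"
              using h abs_triangle_ineq[of "(1 - h) * x r" "h * (x r - x (\<alpha> r))"]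
              by (simp add: abs_mult)
            also have "\<dots> \<le> (1 - h) * K + h * K"
              using h diff upto[of r] r by (intro add_mono mult_left_mono) auto
            also have "\<dots> = K"
              by (simp add: algebra_simps)
            finally show ?thesis .
          qed
        qed (use a t False x A s e phase1[OF a] \<epsilon> in auto)
        then show ?thesis
          using e \<epsilon> by simp
      qed
    qed
    then show "\<exists>\<delta>>0. \<forall>s\<in>T \<inter> {t0..}. \<forall>x0 \<phi> x.
        ivp_solution T A \<alpha> s x0 \<phi> x \<and>
        ennreal \<bar>x0\<bar> + (SUP \<eta> \<in> T \<inter> {alpha_star T \<alpha> s..<s}. ennreal \<bar>\<phi> \<eta>\<bar>) < ennreal \<delta>
        \<longrightarrow> (\<forall>t \<in> T \<inter> {s..}. \<bar>x t\<bar> < \<epsilon>)"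
      using \<delta> by (intro exI[of _ \<delta>]) auto
  qed
qed

end
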